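(* An edge-colored multigraph is a prechromotopology (with colors $[n]$) if and only if it is isomorphic, as an edge-colored multigraph, to the quotient $I^n_c/L$ for some linear binary code $L\subseteq\mathbf{Z}_2^n$.
   Context: Let $[n]=\{1,\dots,n\}$. A prechromotopology of dimension $n$ is a finite connected multigraph (loops and multiple edges allowed) whose edges are colored by $[n]$ so that every vertex is incident to exactly one edge of each color (a loop at $v$ of color $i$ counts as the color-$i$ edge at $v$), and such that the maps $q_i\colon V\to V$ sending $v$ to the other endpoint of its color-$i$ edge (or to $v$ itself for a loop) pairwise commute. A code is a $\mathbf{Z}_2$-subspace $L\subseteq\mathbf{Z}_2^n$; $e_i$ is the $i$-th standard basis vector. The quotient $I^n_c/L$ is the edge-colored multigraph with vertex set $\mathbf{Z}_2^n/L$ having, for each coset $C$ and each color $i$, an edge of color $i$ joining $C$ and $C+e_i$ (one such edge per unordered pair and color; a loop if $e_i\in L$). *)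

theory Defs
  imports Complex_Main "HOL-Library.Z2" "HOL-Library.Function_Algebras" "HOL-Library.Set_Algebras"
begin

section \<open>Edge-colored multigraphs\<close>

text \<open>Edges are objects of their own, so parallel edges (even of the same color) are possible;
  an edge is a loop iff its set of endpoints is a singleton.\<close>

record ('v, 'e) colored_multigraph =
  verts :: "'v set"
  edges :: "'e set"
  ends :: "'e \<Rightarrow> 'v set"
  color :: "'e \<Rightarrow> nat"

locale edge_colored_multigraph =
  fixes G :: "('v, 'e) colored_multigraph"
  assumes ends_wf: "e \<in> edges G \<Longrightarrow> \<exists>u\<in>verts G. \<exists>v\<in>verts G. ends G e = {u, v}"

text \<open>The empty graph does not count as connected.\<close>

definition adjacency :: "('v, 'e) colored_multigraph \<Rightarrow> ('v \<times> 'v) set" where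
  "adjacency G = {(u, v). \<exists>e\<in>edges G. ends G e = {u, v}}"

definition connected_multigraph :: "('v, 'e) colored_multigraph \<Rightarrow> bool" where
  "connected_multigraph G \<longleftrightarrow>
     verts G \<noteq> {} \<and> (\<forall>u\<in>verts G. \<forall>v\<in>verts G. (u, v) \<in> (adjacency G)\<^sup>*)"

definition colored_iso ::
  "('v, 'e) colored_multigraph \<Rightarrow> ('w, 'f) colored_multigraph \<Rightarrow> bool" where
  "colored_iso G H \<longleftrightarrow>
     (\<exists>f g. bij_betw f (verts G) (verts H) \<and> bij_betw g (edges G) (edges H) \<and>
        (\<forall>e\<in>edges G. ends H (g e) = f ` ends G e \<and> color H (g e) = color G e))"

section \<open>Prechromotopologies\<close>

text \<open>These two functions are meaningful only when \<open>v\<close> is incident to exactly one edge of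
  color \<open>i\<close>. For a loop, \<open>ends G e = {v} = {v, v}\<close>, so that \<open>color_nbr G i v = v\<close>.\<close>

definition color_edge :: "('v, 'e) colored_multigraph \<Rightarrow> nat \<Rightarrow> 'v \<Rightarrow> 'e" where
  "color_edge G i v = (THE e. e \<in> edges G \<and> color G e = i \<and> v \<in> ends G e)"

definition color_nbr :: "('v, 'e) colored_multigraph \<Rightarrow> nat \<Rightarrow> 'v \<Rightarrow> 'v" where
  "color_nbr G i v = (THE w. ends G (color_edge G i v) = {v, w})"

locale prechromotopology = edge_colored_multigraph G
  for n :: nat and G :: "('v, 'e) colored_multigraph" +
  assumes finite_verts: "finite (verts G)"
    and finite_edges: "finite (edges G)"
    and connected: "connected_multigraph G"
    and colors: "e \<in> edges G \<Longrightarrow> color G e \<in> {1..n}"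
    and one_edge_per_color: "v \<in> verts G \<Longrightarrow> i \<in> {1..n} \<Longrightarrow>
          \<exists>!e. e \<in> edges G \<and> color G e = i \<and> v \<in> ends G e"
    and commute: "i \<in> {1..n} \<Longrightarrow> j \<in> {1..n} \<Longrightarrow> v \<in> verts G \<Longrightarrow>
          color_nbr G i (color_nbr G j v) = color_nbr G j (color_nbr G i v)"

section \<open>Codes and quotients of the colored cube\<close>

text \<open>Vectors over the two-element field with coordinates indexed by \<open>{1..n}\<close> are functions
  \<^typ>\<open>nat \<Rightarrow> bit\<close> that vanish outside \<open>{1..n}\<close>; addition is pointwise.\<close>

interpretation bitvec: vector_space "\<lambda>(c::bit) (x::nat \<Rightarrow> bit) i. c * x i"
  by unfold_locales (auto simp add: fun_eq_iff distrib_left distrib_right mult.assoc simp del: add_bit_eq_xor mult_bit_eq_and)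

definition Z2_vecs :: "nat \<Rightarrow> (nat \<Rightarrow> bit) set" where
  "Z2_vecs n = {x. \<forall>i. i \<notin> {1..n} \<longrightarrow> x i = 0}"

definition basis_vec :: "nat \<Rightarrow> nat \<Rightarrow> bit" where
  "basis_vec i = (\<lambda>j. if j = i then 1 else 0)"

definition binary_code :: "nat \<Rightarrow> (nat \<Rightarrow> bit) set \<Rightarrow> bool" where
  "binary_code n L \<longleftrightarrow> L \<subseteq> Z2_vecs n \<and> bitvec.subspace L"

text \<open>An edge is the pair of its color and its set of endpoints, so that \<open>C\<close> and
  \<open>basis_vec i +o C\<close> determine the same edge of color \<open>i\<close>.\<close>

definition cube_quotient ::
  "nat \<Rightarrow> (nat \<Rightarrow> bit) set \<Rightarrow> ((nat \<Rightarrow> bit) set, nat \<times> (nat \<Rightarrow> bit) set set) colored_multigraph" where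
  "cube_quotient n L =
     (let cosets = {x +o L |x. x \<in> Z2_vecs n} in
      \<lparr> verts = cosets,
        edges = {(i, {C, basis_vec i +o C}) |i C. i \<in> {1..n} \<and> C \<in> cosets},
        ends = snd,
        color = fst \<rparr>)"

end

(* The commuting involutions q_i define an action of Z_2^n on the vertices, which is transitive
   because the graph is connected. Fixing a vertex v0 and letting L be its stabilizer,
   the map sending v to the set of all x with x v0 = v identifies the vertices with the cosets
   of L and turns q_i into translation by e_i. *)
theory Submission
  imports Defs
begin

section \<open>Vectors over the two-element field\<close>

lemma bitvec_add_self [simp]: "(x :: nat \<Rightarrow> bit) + x = 0"
  by (rule ext) simp

lemma bitvec_add_add_self [simp]: "(x :: nat \<Rightarrow> bit) + (x + y) = y"
  by (simp flip: add.assoc)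

lemma Z2_vecs_zero [simp]: "0 \<in> Z2_vecs n"
  by (simp add: Z2_vecs_def)

lemma Z2_vecs_add: "x \<in> Z2_vecs n \<Longrightarrow> y \<in> Z2_vecs n \<Longrightarrow> x + y \<in> Z2_vecs n"
  by (simp add: Z2_vecs_def)

lemma Z2_vecs_basis_vec: "i \<in> {1..n} \<Longrightarrow> basis_vec i \<in> Z2_vecs n"
  by (auto simp: Z2_vecs_def basis_vec_def)

lemma finite_Z2_vecs: "finite (Z2_vecs n)"
proof -
  have "finite (UNIV :: bit set)"
    by (rule finite_subset[of _ "{0, 1}"]) (auto intro: bit.exhaust)
  from finite_set_of_finite_funs[OF _ this, of "{1..n}" 0] show ?thesis
    by (rule rev_finite_subset) (auto simp: Z2_vecs_def)
qed

text \<open>Induction on the support: adding \<open>basis_vec i\<close> at a support index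
  \<open>i\<close> shrinks the support, and adding it a second time gives back \<open>x\<close>. The
  \<open>add\<close> case leaves \<open>x i\<close> unrestricted, so it speaks of arbitrary sums of
  generators, repetitions included.\<close>

lemma Z2_vecs_induct [consumes 1, case_names zero add]:
  assumes "x \<in> Z2_vecs n"
    and zero: "P 0"
    and add: "\<And>i x. i \<in> {1..n} \<Longrightarrow> x \<in> Z2_vecs n \<Longrightarrow> P x \<Longrightarrow> P (basis_vec i + x)"
  shows "P x"
proof -
  have "finite {i. x i = 1}"
    by (rule finite_subset[of _ "{1..n}"]) (use assms(1) in \<open>force simp: Z2_vecs_def\<close>)+
  then show ?thesis
    using assms(1)
  proof (induction "{i. x i = 1}" arbitrary: x rule: finite_induct)
    case empty
    then have "x = 0"
      by (auto simp: fun_eq_iff)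
    then show ?case
      using zero by (simp only:)
  next
    case (insert i F)
    have xi: "x i = 1"
      using insert.hyps by blast
    then have i: "i \<in> {1..n}"
      using insert.prems unfolding Z2_vecs_def by fastforce
    let ?y = "basis_vec i + x"
    have "F = {j. ?y j = 1}"
    proof (rule set_eqI)
      fix j
      show "j \<in> F \<longleftrightarrow> j \<in> {j. ?y j = 1}"
      proof (cases "j = i")
        case True
        then show ?thesis
          using insert.hyps(2) xi by (simp add: basis_vec_def)
      next
        case False
        then show ?thesis
          using insert.hyps(4) by (auto simp: basis_vec_def)
      qed
    qed
    moreover have y: "?y \<in> Z2_vecs n"
      using i insert.prems by (intro Z2_vecs_add Z2_vecs_basis_vec)
    ultimately have "P ?y"
      by (rule insert.hyps(3))
    from add[OF i y this] show ?case
      by simp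
  qed
qed

text \<open>The only scalars are 0 and 1, so closure under scaling reduces to containing 0.\<close>

lemma binary_codeI:
  assumes "L \<subseteq> Z2_vecs n" "0 \<in> L" "\<And>x y. x \<in> L \<Longrightarrow> y \<in> L \<Longrightarrow> x + y \<in> L"
  shows "binary_code n L"
  unfolding binary_code_def
proof (intro conjI bitvec.subspaceI)
  fix c :: bit and x assume "x \<in> L"
  then show "(\<lambda>i. c * x i) \<in> L"
    using assms(2) by (cases c) (simp_all add: zero_fun_def del: mult_bit_eq_and)
qed (use assms in auto)


section \<open>Neighbors along a color\<close>

context edge_colored_multigraph
begin

lemma ends_subset: "e \<in> edges G \<Longrightarrow> ends G e \<subseteq> verts G"
  using ends_wf by fastforce

lemma ends_cases:
  assumes "e \<in> edges G" "v \<in> ends G e"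
  obtains w where "w \<in> verts G" "ends G e = {v, w}"
proof -
  obtain a b where "a \<in> verts G" "b \<in> verts G" "ends G e = {a, b}"
    using ends_wf[OF assms(1)] by blast
  with assms(2) that[of a] that[of b] show thesis
    by (auto simp: insert_commute)
qed

end

lemma doubleton_cancel_left: "{a, b} = {a, c} \<longleftrightarrow> b = c"
  by (auto simp: doubleton_eq_iff)

text \<open>Resolves both definite descriptions at once: uniqueness of the edge determines
  \<open>color_edge\<close>, and a pair \<open>{v, w}\<close> with \<open>v\<close> known determines
  \<open>w\<close>, also for a loop, where \<open>w = v\<close>.\<close>

lemma color_nbr_eqI:
  assumes "\<exists>!e. e \<in> edges G \<and> color G e = i \<and> v \<in> ends G e"
    and "e \<in> edges G" "color G e = i" "ends G e = {v, w}"
  shows "color_nbr G i v = w"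
proof -
  have "color_edge G i v = e"
    unfolding color_edge_def by (rule the1_equality) (use assms in simp_all)
  then have "color_nbr G i v = (THE w'. {v, w} = {v, w'})"
    unfolding color_nbr_def by (simp only: assms(4))
  also have "\<dots> = w"
    by (simp add: doubleton_cancel_left)
  finally show ?thesis .
qed

context prechromotopology
begin

lemma color_nbr_edge:
  assumes "v \<in> verts G" "i \<in> {1..n}"
  obtains e where "e \<in> edges G" "color G e = i" "ends G e = {v, color_nbr G i v}"
proof -
  obtain e where e: "e \<in> edges G" "color G e = i" "v \<in> ends G e"
    using one_edge_per_color[OF assms] by blast
  from e(1,3) obtain w where w: "w \<in> verts G" "ends G e = {v, w}"
    by (rule ends_cases)
  have "color_nbr G i v = w"
    by (rule color_nbr_eqI[OF one_edge_per_color[OF assms] e(1,2) w(2)])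
  then show thesis
    using that e w by simp
qed

lemma ends_eq_color_nbr:
  assumes "e \<in> edges G" "v \<in> ends G e"
  shows "ends G e = {v, color_nbr G (color G e) v}"
proof -
  have v: "v \<in> verts G"
    using assms ends_subset by blast
  obtain w where w: "w \<in> verts G" "ends G e = {v, w}"
    using assms by (rule ends_cases)
  have "color_nbr G (color G e) v = w"
    by (rule color_nbr_eqI[OF one_edge_per_color[OF v colors[OF assms(1)]] assms(1) refl w(2)])
  with w show ?thesis
    by simp
qed

lemma color_nbr_in_verts:
  assumes "v \<in> verts G" "i \<in> {1..n}"
  shows "color_nbr G i v \<in> verts G"
proof -
  obtain e where "e \<in> edges G" "color G e = i" "ends G e = {v, color_nbr G i v}"
    using assms by (rule color_nbr_edge)
  then show ?thesis
    using ends_subset by blast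
qed

text \<open>The edge of color \<open>i\<close> at \<open>v\<close> is also the edge of color
  \<open>i\<close> at its other end; read from there, it leads back to \<open>v\<close>.\<close>

lemma color_nbr_involution:
  assumes "v \<in> verts G" "i \<in> {1..n}"
  shows "color_nbr G i (color_nbr G i v) = v"
proof -
  obtain e where e: "e \<in> edges G" "color G e = i" "ends G e = {v, color_nbr G i v}"
    using assms by (rule color_nbr_edge)
  show ?thesis
    by (rule color_nbr_eqI[OF one_edge_per_color[OF color_nbr_in_verts[OF assms] assms(2)] e(1,2)])
      (use e(3) in blast)
qed

end


section \<open>The action of the cube on the vertices\<close>

context prechromotopology
begin

text \<open>The commutation axiom says nothing outside \<^term>\<open>verts G\<close>, so we extend by the identity
  there to get commuting maps on the whole type.\<close>

definition flip_color :: "nat \<Rightarrow> 'v \<Rightarrow> 'v" where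
  "flip_color i v = (if v \<in> verts G then color_nbr G i v else v)"

text \<open>Composes the flips of all colors in the support of \<open>x\<close>. For
  \<open>x\<close> in \<open>Z2_vecs n\<close> the support is finite and the flips commute, so the
  order of the fold is irrelevant.\<close>

definition act :: "(nat \<Rightarrow> bit) \<Rightarrow> 'v \<Rightarrow> 'v" where
  "act x v = Finite_Set.fold flip_color v {i. x i = 1}"

lemma flip_color_flip_color: "i \<in> {1..n} \<Longrightarrow> flip_color i (flip_color i v) = v"
  by (simp add: flip_color_def color_nbr_in_verts color_nbr_involution)

lemma comp_fun_commute_on_flip_color: "comp_fun_commute_on {1..n} flip_color"
  by unfold_locales (auto simp: fun_eq_iff flip_color_def color_nbr_in_verts commute)

lemma act_zero [simp]: "act 0 v = v"
  by (simp add: act_def)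

text \<open>Here addition modulo 2 meets the involutions. If \<open>x i = 0\<close>, the support
  gains \<open>i\<close> and the fold gains one flip. If \<open>x i = 1\<close>, the first case
  applies to \<open>basis_vec i + x\<close>, and two flips of color \<open>i\<close> cancel.\<close>

lemma act_basis_vec_add:
  assumes i: "i \<in> {1..n}" and x: "x \<in> Z2_vecs n"
  shows "act (basis_vec i + x) v = flip_color i (act x v)"
proof -
  interpret comp_fun_commute_on "{1..n}" flip_color
    by (rule comp_fun_commute_on_flip_color)
  have step: "act (basis_vec i + y) v = flip_color i (act y v)"
    if y: "y \<in> Z2_vecs n" "y i = 0" for y
  proof -
    have "{j. (basis_vec i + y) j = 1} = insert i {j. y j = 1}"
      using y(2) by (auto simp: basis_vec_def)
    moreover have "{j. y j = 1} \<subseteq> {1..n}"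
      using y(1) by (force simp: Z2_vecs_def)
    ultimately show ?thesis
      unfolding act_def using i y(2)
      by (simp only:) (rule fold_insert, auto intro: finite_subset)
  qed
  show ?thesis
  proof (cases "x i = 0")
    case True
    with x show ?thesis
      by (rule step)
  next
    case False
    let ?y = "basis_vec i + x"
    have "act (basis_vec i + ?y) v = flip_color i (act ?y v)"
      by (rule step) (use i x False in \<open>simp_all add: Z2_vecs_add Z2_vecs_basis_vec, simp add: basis_vec_def\<close>)
    then show ?thesis
      by (simp add: flip_color_flip_color[OF i])
  qed
qed

text \<open>Together with \<open>act_zero\<close> this makes \<open>act\<close> a group action of
  \<open>Z2_vecs n\<close>; the induction peels off one generator of \<open>x\<close> at a
  time.\<close>

lemma act_add:
  assumes "x \<in> Z2_vecs n" "y \<in> Z2_vecs n"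
  shows "act (x + y) v = act x (act y v)"
  using assms(1)
proof (induction x rule: Z2_vecs_induct)
  case zero
  show "act (0 + y) v = act 0 (act y v)"
    by simp
next
  case (add i x)
  then show "act (basis_vec i + x + y) v = act (basis_vec i + x) (act y v)"
    by (simp only: add.assoc act_basis_vec_add Z2_vecs_add assms(2))
qed

lemma act_in_verts:
  assumes "x \<in> Z2_vecs n" "v \<in> verts G"
  shows "act x v \<in> verts G"
  using assms(1)
proof (induction x rule: Z2_vecs_induct)
  case zero
  show "act 0 v \<in> verts G"
    by (simp add: assms(2))
next
  case (add i x)
  then show "act (basis_vec i + x) v \<in> verts G"
    by (simp add: act_basis_vec_add flip_color_def color_nbr_in_verts)
qed

text \<open>The colors met along a walk from \<open>u\<close> to \<open>v\<close> give basis vectors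
  whose sum carries \<open>u\<close> to \<open>v\<close>.\<close>

lemma act_transitive:
  assumes "u \<in> verts G" "v \<in> verts G"
  shows "\<exists>x\<in>Z2_vecs n. act x u = v"
proof -
  have "(u, v) \<in> (adjacency G)\<^sup>*"
    using connected assms by (simp add: connected_multigraph_def)
  then show ?thesis
  proof (induction rule: rtrancl_induct)
    case base
    then show ?case
      by (metis Z2_vecs_zero act_zero)
  next
    case (step v w)
    then obtain x where x: "x \<in> Z2_vecs n" "act x u = v"
      by blast
    obtain e where e: "e \<in> edges G" "ends G e = {v, w}"
      using step.hyps(2) by (auto simp: adjacency_def)
    let ?i = "color G e"
    have i: "?i \<in> {1..n}"
      using e(1) by (rule colors)
    have "{v, w} = {v, color_nbr G ?i v}"
      using ends_eq_color_nbr[OF e(1), of v] unfolding e(2) by blast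
    then have "color_nbr G ?i v = w"
      unfolding doubleton_cancel_left by (rule sym)
    moreover have "v \<in> verts G"
      using e ends_subset by blast
    ultimately have "act (basis_vec ?i + x) u = w"
      using x i by (simp add: act_basis_vec_add flip_color_def)
    then show ?case
      using Z2_vecs_add[OF Z2_vecs_basis_vec[OF i] x(1)] by blast
  qed
qed

section \<open>The stabilizer, its cosets and the isomorphism onto the quotient\<close>

lemma binary_code_stabilizer: "binary_code n {x \<in> Z2_vecs n. act x v = v}"
  by (rule binary_codeI) (auto simp: Z2_vecs_add act_add)

text \<open>Every vector is its own inverse, so \<open>x + y\<close> serves as the difference of
  \<open>x\<close> and \<open>y\<close>: it fixes \<open>v\<close> exactly when \<open>x\<close> and
  \<open>y\<close> carry \<open>v\<close> to the same vertex.\<close>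

lemma transporter_eq_coset:
  assumes "x \<in> Z2_vecs n"
  shows "{y \<in> Z2_vecs n. act y v = act x v} = x +o {y \<in> Z2_vecs n. act y v = v}"
    (is "?A = x +o ?L")
proof (intro set_eqI iffI)
  fix y assume y: "y \<in> ?A"
  have "act (x + y) v = act (x + x) v"
    using y assms by (simp only: act_add mem_Collect_eq)
  then have "x + y \<in> ?L"
    using y assms by (simp add: Z2_vecs_add)
  then show "y \<in> x +o ?L"
    unfolding elt_set_plus_def by (intro CollectI bexI[of _ "x + y"]) simp_all
next
  fix y assume "y \<in> x +o ?L"
  then show "y \<in> ?A"
    using assms by (auto simp: elt_set_plus_def Z2_vecs_add act_add)
qed

lemma colored_iso_cube_quotient:
  assumes v0: "v0 \<in> verts G"
  shows "colored_iso G (cube_quotient n {x \<in> Z2_vecs n. act x v0 = v0})"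
proof -
  define L where "L = {x \<in> Z2_vecs n. act x v0 = v0}"
  define f where "f v = {x \<in> Z2_vecs n. act x v0 = v}" for v
  \<comment> \<open>This choice is forced: an edge of the quotient is nothing but its color paired
    with its endpoints.\<close>
  define g where "g e = (color G e, f ` ends G e)" for e
  let ?H = "cube_quotient n L"
  have f_act: "f (act x v0) = x +o L" if "x \<in> Z2_vecs n" for x
    using that unfolding f_def L_def by (rule transporter_eq_coset)
  \<comment> \<open>Writing \<open>v\<close> as \<open>act x v0\<close>, a step along color
    \<open>i\<close> replaces \<open>x\<close> by \<open>basis_vec i + x\<close>, hence translates
    the coset.\<close>
  have f_nbr: "f (color_nbr G i v) = basis_vec i +o f v" if v: "v \<in> verts G" and i: "i \<in> {1..n}" for i v
  proof -
    obtain x where x: "x \<in> Z2_vecs n" "act x v0 = v"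
      using act_transitive[OF v0 v] by blast
    then have "color_nbr G i v = act (basis_vec i + x) v0"
      using v i by (simp add: act_basis_vec_add flip_color_def)
    then show ?thesis
      using x i f_act[of x] f_act[of "basis_vec i + x"]
      by (simp add: Z2_vecs_add Z2_vecs_basis_vec set_plus_rearrange2)
  qed
  \<comment> \<open>Each \<open>f u\<close> is nonempty by transitivity, and any element of it
    determines \<open>u\<close> as its image of \<open>v0\<close>.\<close>
  have inj_f: "inj_on f (verts G)"
  proof (rule inj_onI)
    fix u v assume u: "u \<in> verts G" and uv: "f u = f v"
    obtain x where "x \<in> f u"
      using act_transitive[OF v0 u] by (auto simp: f_def)
    moreover from this have "x \<in> f v"
      using uv by simp
    ultimately show "u = v"
      by (simp add: f_def)
  qed
  have f_image: "f ` verts G = verts ?H"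
  proof (intro equalityI subsetI)
    fix C assume "C \<in> f ` verts G"
    then obtain v where v: "v \<in> verts G" "C = f v"
      by blast
    obtain x where "x \<in> Z2_vecs n" "act x v0 = v"
      using act_transitive[OF v0 v(1)] by blast
    then show "C \<in> verts ?H"
      using v(2) f_act by (auto simp: cube_quotient_def)
  next
    fix C assume "C \<in> verts ?H"
    then obtain x where "x \<in> Z2_vecs n" "C = x +o L"
      by (auto simp: cube_quotient_def)
    then show "C \<in> f ` verts G"
      using f_act[of x] act_in_verts[of x v0] v0 by blast
  qed
  \<comment> \<open>Injectivity of \<open>f\<close> recovers the endpoints from their images; the
    color and one endpoint then single out the edge.\<close>
  have inj_g: "inj_on g (edges G)"
  proof (rule inj_onI)
    fix d e assume d: "d \<in> edges G" and e: "e \<in> edges G" and "g d = g e"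
    then have col: "color G d = color G e" and "f ` ends G d = f ` ends G e"
      by (simp_all add: g_def)
    then have ends: "ends G d = ends G e"
      using inj_on_image_eq_iff[OF inj_f ends_subset[OF d] ends_subset[OF e]] by simp
    obtain v where v: "v \<in> verts G" "v \<in> ends G d"
      using ends_wf[OF d] by blast
    then show "d = e"
      using one_edge_per_color[OF v(1) colors[OF d]] d e col ends by metis
  qed
  have g_eq: "g e = (i, {f v, basis_vec i +o f v})"
    if "v \<in> verts G" "i \<in> {1..n}" "color G e = i" "ends G e = {v, color_nbr G i v}" for e v i
    using that by (simp add: g_def f_nbr)
  \<comment> \<open>Writing the cosets as values of \<open>f\<close> presents every edge of the
    quotient by a vertex of \<open>G\<close> and a color, the form that \<open>g_eq\<close>
    produces.\<close>
  have edges_H: "edges ?H = {(i, {C, basis_vec i +o C}) |i C. i \<in> {1..n} \<and> C \<in> f ` verts G}"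
    unfolding f_image by (simp add: cube_quotient_def)
  have g_image: "g ` edges G = edges ?H"
  proof (intro equalityI subsetI)
    fix p assume "p \<in> g ` edges G"
    then obtain e where e: "e \<in> edges G" "p = g e"
      by blast
    obtain v where v: "v \<in> verts G" "v \<in> ends G e"
      using ends_wf[OF e(1)] by blast
    have "p = (color G e, {f v, basis_vec (color G e) +o f v})"
      using g_eq[OF v(1) colors[OF e(1)] refl ends_eq_color_nbr[OF e(1) v(2)]] e(2) by simp
    then show "p \<in> edges ?H"
      unfolding edges_H using colors[OF e(1)] v(1) by blast
  next
    fix p assume "p \<in> edges ?H"
    then obtain i v where iv: "i \<in> {1..n}" "v \<in> verts G" "p = (i, {f v, basis_vec i +o f v})"
      unfolding edges_H by blast
    obtain e where e: "e \<in> edges G" "color G e = i" "ends G e = {v, color_nbr G i v}"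
      using iv(2,1) by (rule color_nbr_edge)
    show "p \<in> g ` edges G"
      using g_eq[OF iv(2,1) e(2,3)] iv(3) e(1) by (metis imageI)
  qed
  have "colored_iso G ?H"
    unfolding colored_iso_def
  proof (intro exI conjI)
    show "bij_betw f (verts G) (verts ?H)"
      using inj_f f_image by (simp add: bij_betw_def)
    show "bij_betw g (edges G) (edges ?H)"
      using inj_g g_image by (simp add: bij_betw_def)
    show "\<forall>e\<in>edges G. ends ?H (g e) = f ` ends G e \<and> color ?H (g e) = color G e"
      by (simp add: cube_quotient_def g_def)
  qed
  then show ?thesis
    by (simp add: L_def)
qed

end


section \<open>Quotients of the cube\<close>

lemma bitvec_translate_translate [simp]: "(x :: nat \<Rightarrow> bit) +o (x +o C) = C"
  by (simp add: set_plus_rearrange2)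

lemma verts_cube_quotient: "verts (cube_quotient n L) = {x +o L |x. x \<in> Z2_vecs n}"
  and edges_cube_quotient: "edges (cube_quotient n L) =
    {(i, {C, basis_vec i +o C}) |i C. i \<in> {1..n} \<and> C \<in> verts (cube_quotient n L)}"
  and ends_cube_quotient: "ends (cube_quotient n L) = snd"
  and color_cube_quotient: "color (cube_quotient n L) = fst"
  by (simp_all add: cube_quotient_def)

lemma translate_in_verts_cube_quotient:
  assumes "x \<in> Z2_vecs n" "C \<in> verts (cube_quotient n L)"
  shows "x +o C \<in> verts (cube_quotient n L)"
proof -
  obtain y where "y \<in> Z2_vecs n" "C = y +o L"
    using assms(2) by (auto simp: verts_cube_quotient)
  then show ?thesis
    using Z2_vecs_add[OF assms(1)] by (auto simp: verts_cube_quotient set_plus_rearrange2)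
qed

text \<open>The neighbor along color \<open>i\<close> is the translate by
  \<open>basis_vec i\<close>. Such translations are involutions, which gives one edge per color;
  they commute because addition does; and sums of basis vectors reach all vertices.\<close>

lemma prechromotopology_cube_quotient: "prechromotopology n (cube_quotient n L)"
proof -
  let ?H = "cube_quotient n L"
  have nbr: "basis_vec i +o C \<in> verts ?H" if "i \<in> {1..n}" "C \<in> verts ?H" for i C
    using that by (intro translate_in_verts_cube_quotient Z2_vecs_basis_vec)
  \<comment> \<open>An edge looks the same from both ends: if \<open>C\<close> is the translated
    end, translating it again gives the other one.\<close>
  have edge_eq: "e = (i, {C, basis_vec i +o C})"
    if "e \<in> edges ?H" "fst e = i" "C \<in> snd e" for e i C
    using that by (auto simp: edges_cube_quotient)
  have unique: "\<exists>!e. e \<in> edges ?H \<and> color ?H e = i \<and> C \<in> ends ?H e"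
    if "i \<in> {1..n}" "C \<in> verts ?H" for i C
  proof (rule ex1I[of _ "(i, {C, basis_vec i +o C})"])
    show "(i, {C, basis_vec i +o C}) \<in> edges ?H \<and> color ?H (i, {C, basis_vec i +o C}) = i \<and>
        C \<in> ends ?H (i, {C, basis_vec i +o C})"
      using that by (auto simp: edges_cube_quotient ends_cube_quotient color_cube_quotient)
  qed (use edge_eq in \<open>simp add: ends_cube_quotient color_cube_quotient\<close>)
  have color_nbr: "color_nbr ?H i C = basis_vec i +o C"
    if "i \<in> {1..n}" "C \<in> verts ?H" for i C
    by (rule color_nbr_eqI[OF unique[OF that], of "(i, {C, basis_vec i +o C})"])
      (use that in \<open>auto simp: edges_cube_quotient ends_cube_quotient color_cube_quotient\<close>)
  have finite_verts: "finite (verts ?H)"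
    unfolding verts_cube_quotient using finite_Z2_vecs by simp
  \<comment> \<open>Each generator added to \<open>x\<close> prolongs the path by one edge of that
    color.\<close>
  have reach: "(C, x +o C) \<in> (adjacency ?H)\<^sup>*" if C: "C \<in> verts ?H" and "x \<in> Z2_vecs n" for C x
    using that(2)
  proof (induction x rule: Z2_vecs_induct)
    case zero
    show "(C, 0 +o C) \<in> (adjacency ?H)\<^sup>*"
      by simp
  next
    case (add i x)
    have "x +o C \<in> verts ?H"
      using add.hyps(2) C by (rule translate_in_verts_cube_quotient)
    then have "(i, {x +o C, basis_vec i +o (x +o C)}) \<in> edges ?H"
      using add.hyps(1) unfolding edges_cube_quotient by blast
    then have "(x +o C, basis_vec i +o (x +o C)) \<in> adjacency ?H"
      by (force simp: adjacency_def ends_cube_quotient)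
    with add.IH show "(C, (basis_vec i + x) +o C) \<in> (adjacency ?H)\<^sup>*"
      by (simp add: set_plus_rearrange2)
  qed
  have connected: "connected_multigraph ?H"
    unfolding connected_multigraph_def
  proof (intro conjI ballI)
    show "verts ?H \<noteq> {}"
      using Z2_vecs_zero unfolding verts_cube_quotient by blast
  next
    fix C D assume C: "C \<in> verts ?H" and "D \<in> verts ?H"
    then obtain x y where x: "x \<in> Z2_vecs n" "C = x +o L" and y: "y \<in> Z2_vecs n" "D = y +o L"
      by (auto simp: verts_cube_quotient)
    \<comment> \<open>Going from \<open>x +o L\<close> to \<open>y +o L\<close> takes the difference
      of \<open>y\<close> and \<open>x\<close>, which over two elements is their sum.\<close>
    have "D = (y + x) +o C"
      by (simp add: x(2) y(2) set_plus_rearrange2 add.assoc)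
    then show "(C, D) \<in> (adjacency ?H)\<^sup>*"
      using reach[OF C Z2_vecs_add[OF y(1) x(1)]] by simp
  qed
  show ?thesis
  proof
    fix e assume "e \<in> edges ?H"
    then show "\<exists>u\<in>verts ?H. \<exists>v\<in>verts ?H. ends ?H e = {u, v}"
      unfolding edges_cube_quotient ends_cube_quotient using nbr by fastforce
  next
    have "edges ?H \<subseteq> (\<lambda>(i, C). (i, {C, basis_vec i +o C})) ` ({1..n} \<times> verts ?H)"
      unfolding edges_cube_quotient by auto
    then show "finite (edges ?H)"
      by (rule finite_subset) (simp add: finite_verts)
  next
    fix e assume "e \<in> edges ?H"
    then show "color ?H e \<in> {1..n}"
      by (auto simp: edges_cube_quotient color_cube_quotient)
  next
    fix i j C assume "i \<in> {1..n}" "j \<in> {1..n}" "C \<in> verts ?H"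
    then show "color_nbr ?H i (color_nbr ?H j C) = color_nbr ?H j (color_nbr ?H i C)"
      by (simp add: color_nbr nbr set_plus_rearrange2 add.commute)
  qed (use unique finite_verts connected in auto)
qed

section \<open>Invariance under isomorphism\<close>

text \<open>The bijections pull each axiom back from \<open>H\<close> to \<open>G\<close>. That
  \<open>G\<close> is well formed is a separate assumption: \<open>f\<close> is controlled only on
  \<open>verts G\<close>, so comparing images alone would not keep the endpoints of an edge inside
  that set.\<close>

lemma prechromotopology_colored_iso:
  assumes "edge_colored_multigraph G" "prechromotopology n H" "colored_iso G H"
  shows "prechromotopology n G"
proof -
  interpret G: edge_colored_multigraph G by fact
  interpret H: prechromotopology n H by fact
  obtain f g where f: "bij_betw f (verts G) (verts H)" and g: "bij_betw g (edges G) (edges H)"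
    and ends_g: "\<And>e. e \<in> edges G \<Longrightarrow> ends H (g e) = f ` ends G e"
    and color_g: "\<And>e. e \<in> edges G \<Longrightarrow> color H (g e) = color G e"
    using assms(3) unfolding colored_iso_def by blast
  have inj_f: "inj_on f (verts G)"
    using f by (simp add: bij_betw_def)
  have fv: "f v \<in> verts H" if "v \<in> verts G" for v
    using bij_betwE[OF f] that by blast
  have ge: "g e \<in> edges H" if "e \<in> edges G" for e
    using bij_betwE[OF g] that by blast
  have in_ends: "f v \<in> ends H (g e) \<longleftrightarrow> v \<in> ends G e" if "v \<in> verts G" "e \<in> edges G" for v e
    using that G.ends_subset inj_f by (simp add: ends_g inj_on_image_mem_iff)
  \<comment> \<open>Existence comes from surjectivity of \<open>g\<close>, uniqueness from its
    injectivity, both applied to the edge of color \<open>i\<close> at \<open>f v\<close> in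
    \<open>H\<close>.\<close>
  have unique: "\<exists>!e. e \<in> edges G \<and> color G e = i \<and> v \<in> ends G e"
    if v: "v \<in> verts G" and i: "i \<in> {1..n}" for v i
  proof -
    obtain d where d: "d \<in> edges H" "color H d = i" "f v \<in> ends H d"
      using H.one_edge_per_color[OF fv[OF v] i] by blast
    from d(1) obtain e where "e \<in> edges G" "d = g e"
      unfolding bij_betw_imp_surj_on[OF g, symmetric] by blast
    with d have e: "e \<in> edges G" "color G e = i" "v \<in> ends G e"
      using color_g in_ends v by auto
    have "e' = e" if e': "e' \<in> edges G" "color G e' = i" "v \<in> ends G e'" for e'
    proof -
      have "g e' = g e"
        using H.one_edge_per_color[OF fv[OF v] i] e e' ge color_g in_ends v by metis
      then show ?thesis
        using g e e' by (auto simp: bij_betw_def inj_on_def)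
    qed
    with e show ?thesis
      by blast
  qed
  \<comment> \<open>\<open>f\<close> intertwines the neighbor maps; this is what transports
    commutation.\<close>
  have nbr: "color_nbr G i v \<in> verts G \<and> f (color_nbr G i v) = color_nbr H i (f v)"
    if v: "v \<in> verts G" and i: "i \<in> {1..n}" for v i
  proof -
    obtain e where e: "e \<in> edges G" "color G e = i" "v \<in> ends G e"
      using unique[OF v i] by blast
    from e(1,3) obtain w where w: "w \<in> verts G" "ends G e = {v, w}"
      by (rule G.ends_cases)
    have "color_nbr G i v = w"
      by (rule color_nbr_eqI[OF unique[OF v i] e(1,2) w(2)])
    moreover have "color_nbr H i (f v) = f w"
      by (rule color_nbr_eqI[OF H.one_edge_per_color[OF fv[OF v] i] ge[OF e(1)]])
        (use e w in \<open>simp_all add: color_g ends_g\<close>)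
    ultimately show ?thesis
      using w(1) by simp
  qed
  \<comment> \<open>Paths of \<open>H\<close> lift to \<open>G\<close> edge by edge from a given
    starting vertex. The end of the lift is left existential for the induction; injectivity of
    \<open>f\<close> identifies it afterwards.\<close>
  have reach: "\<exists>v'\<in>verts G. f v' = w \<and> (u, v') \<in> (adjacency G)\<^sup>*"
    if "(f u, w) \<in> (adjacency H)\<^sup>*" "u \<in> verts G" for u w
    using that(1)
  proof (induction rule: rtrancl_induct)
    case base
    then show ?case
      using that(2) by blast
  next
    case (step w z)
    then obtain v' where v': "v' \<in> verts G" "f v' = w" "(u, v') \<in> (adjacency G)\<^sup>*"
      by blast
    obtain d where d: "d \<in> edges H" "ends H d = {w, z}"
      using step.hyps(2) by (auto simp: adjacency_def)
    from d(1) obtain e where "e \<in> edges G" "d = g e"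
      unfolding bij_betw_imp_surj_on[OF g, symmetric] by blast
    with d(2) have e: "e \<in> edges G" "f ` ends G e = {w, z}"
      using ends_g by auto
    then have "v' \<in> ends G e"
      using in_ends[OF v'(1) e(1)] v'(2) by (simp add: ends_g)
    with e(1) obtain x where x: "x \<in> verts G" "ends G e = {v', x}"
      by (rule G.ends_cases)
    then have "(v', x) \<in> adjacency G"
      using e(1) by (auto simp: adjacency_def)
    moreover have "f x = z"
      \<comment> \<open>The image of \<open>{v', x}\<close> is \<open>{w, z}\<close> and
        \<open>f v' = w\<close>, so the remaining end matches, also when
        \<open>w = z\<close>.\<close>
      using e(2) unfolding x(2) by (simp add: v'(2) doubleton_cancel_left)
    ultimately show ?case
      using v'(3) x(1) by (auto intro: rtrancl_into_rtrancl)
  qed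
  show ?thesis
  proof
    show "finite (verts G)" "finite (edges G)"
      using bij_betw_finite[OF f] bij_betw_finite[OF g] H.finite_verts H.finite_edges by simp_all
  next
    show "connected_multigraph G"
      unfolding connected_multigraph_def
    proof (intro conjI ballI)
      show "verts G \<noteq> {}"
        using H.connected bij_betw_imp_surj_on[OF f] by (auto simp: connected_multigraph_def)
    next
      fix u v assume u: "u \<in> verts G" and v: "v \<in> verts G"
      have "(f u, f v) \<in> (adjacency H)\<^sup>*"
        using H.connected fv[OF u] fv[OF v] by (simp add: connected_multigraph_def)
      from reach[OF this u] show "(u, v) \<in> (adjacency G)\<^sup>*"
        using inj_f v by (metis inj_onD)
    qed
  next
    fix e assume "e \<in> edges G"
    then show "color G e \<in> {1..n}"
      using H.colors[OF ge] color_g by simp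
  next
    fix i j v assume ij: "i \<in> {1..n}" "j \<in> {1..n}" and v: "v \<in> verts G"
    have eq: "f (color_nbr G i (color_nbr G j v)) = f (color_nbr G j (color_nbr G i v))"
      using nbr v ij H.commute[OF ij fv[OF v]] by simp
    then show "color_nbr G i (color_nbr G j v) = color_nbr G j (color_nbr G i v)"
      using inj_onD[OF inj_f eq] nbr v ij by simp
  qed (rule unique)
qed

theorem mainTheorem2:
  fixes n :: nat and G :: "('v, 'e) colored_multigraph"
  assumes "edge_colored_multigraph G"
  shows "prechromotopology n G \<longleftrightarrow>
           (\<exists>L. binary_code n L \<and> colored_iso G (cube_quotient n L))"
proof
  assume "prechromotopology n G"
  then interpret prechromotopology n G .
  \<comment> \<open>The base vertex is arbitrary; one exists because connectedness excludes the
    empty graph.\<close>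
  obtain v0 where "v0 \<in> verts G"
    using connected by (auto simp: connected_multigraph_def)
  then show "\<exists>L. binary_code n L \<and> colored_iso G (cube_quotient n L)"
    using binary_code_stabilizer colored_iso_cube_quotient by blast
next
  assume "\<exists>L. binary_code n L \<and> colored_iso G (cube_quotient n L)"
  then show "prechromotopology n G"
    using prechromotopology_colored_iso[OF assms prechromotopology_cube_quotient] by blast
qed

end
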